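(* Let $(X,p)$ be a finite dimensional asymmetric normed space. The following statements are equivalent: (1) $p$ is right bounded. (2) There exists an asymmetric norm $q$ on $X$, equivalent to $p$, such that $q$ is $1$-bounded. (3) There exists an asymmetric norm $q$ on $X$, equivalent to $p$, such that the closed ball $B_1^q[0]$ is strongly compact (in $(X,q)$). (4) $(X,p)$ is strongly locally compact.
   Context: An asymmetric norm on a real linear space $X$ is a function $q:X\to[0,\infty)$ such that (i) $q(ax)=a\,q(x)$ for all $x\in X$, $a\ge 0$; (ii) $q(x+y)\le q(x)+q(y)$ for all $x,y\in X$; (iii) if $q(x)=q(-x)=0$ then $x=0$. The pair $(X,q)$ is an asymmetric normed space. The topology $\tau_q$ of $(X,q)$ is the one generated by the open balls $B^q_\varepsilon(x)=\{y\in X: q(y-x)<\varepsilon\}$; topological notions refer to $\tau_q$ unless indicated otherwise. The closed ball is $B^q_\varepsilon[x]=\{y\in X: q(y-x)\le\varepsilon\}$. Let $\theta_q=\{x\in X: q(x)=0\}$ and let $q^s(x)=\max\{q(x),q(-x)\}$, which is a norm on $X$; $B_\varepsilon^{q^s}[x]$ denotes its closed balls. "$q^s$-compact" means compact in the topology of the norm $q^s$. Two asymmetric norms $q,p$ on $X$ are equivalent if there are $\kappa,\lambda>0$ with $\kappa q(x)\le p(x)\le\lambda q(x)$ for all $x\in X$. $q$ is right bounded if there is $r>0$ with $rB_1^q[0]\subset B_1^{q^s}[0]+\theta_q$; it is $1$-bounded if this holds with $r=1$. A set $K\subset X$ is strongly compact (in $(X,q)$) if there is a $q^s$-compact set $S\subset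 X$ with $S\subset K\subset S+\theta_q$. $(X,q)$ is strongly locally compact if every point has a local base (of neighborhoods with respect to $\tau_q$) consisting of strongly compact sets. *)

theory Defs
  imports "HOL-Analysis.Analysis" "HOL-Library.Set_Algebras"
begin

definition asym_norm :: "('a::real_vector \<Rightarrow> real) \<Rightarrow> bool" where
  "asym_norm q \<longleftrightarrow>
     (\<forall>x. 0 \<le> q x) \<and>
     (\<forall>a x. 0 \<le> a \<longrightarrow> q (a *\<^sub>R x) = a * q x) \<and>
     (\<forall>x y. q (x + y) \<le> q x + q y) \<and>
     (\<forall>x. q x = 0 \<and> q (- x) = 0 \<longrightarrow> x = 0)"

definition asym_ball :: "('a::real_vector \<Rightarrow> real) \<Rightarrow> 'a \<Rightarrow> real \<Rightarrow> 'a set" where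
  "asym_ball q x e = {y. q (y - x) < e}"

definition asym_cball :: "('a::real_vector \<Rightarrow> real) \<Rightarrow> 'a \<Rightarrow> real \<Rightarrow> 'a set" where
  "asym_cball q x e = {y. q (y - x) \<le> e}"

definition asym_topology :: "('a::real_vector \<Rightarrow> real) \<Rightarrow> 'a topology" where
  "asym_topology q = topology_generated_by {asym_ball q x e | x e. 0 < e}"

definition asym_kernel :: "('a::real_vector \<Rightarrow> real) \<Rightarrow> 'a set" where
  "asym_kernel q = {x. q x = 0}"

definition sym_norm :: "('a::real_vector \<Rightarrow> real) \<Rightarrow> 'a \<Rightarrow> real" where
  "sym_norm q x = max (q x) (q (- x))"

definition sym_topology :: "('a::real_vector \<Rightarrow> real) \<Rightarrow> 'a topology" where
  "sym_topology q = Metric_space.mtopology UNIV (\<lambda>x y. sym_norm q (x - y))"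

text \<open>Outside the locale, \<^const>\<open>Metric_space.mtopology\<close> is meaningful only for an actual metric.\<close>

lemma Metric_space_sym_norm:
  assumes "asym_norm q"
  shows "Metric_space UNIV (\<lambda>x y. sym_norm q (x - y))"
proof
  fix x y z :: 'a
  have nonneg: "0 \<le> q u" and tri: "q (u + v) \<le> q u + q v"
    and zero: "q u = 0 \<Longrightarrow> q (- u) = 0 \<Longrightarrow> u = 0" for u v
    using assms by (auto simp: asym_norm_def)
  have q0: "q 0 = 0"
    using assms unfolding asym_norm_def by (metis mult_zero_left order_refl scale_zero_left)
  show "0 \<le> sym_norm q (x - y)"
    by (simp add: sym_norm_def le_max_iff_disj nonneg)
  show "sym_norm q (x - y) = sym_norm q (y - x)"
    by (simp add: sym_norm_def max.commute)
  show "sym_norm q (x - y) = 0 \<longleftrightarrow> x = y"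
    using zero[of "x - y"] nonneg[of "x - y"] nonneg[of "y - x"]
    by (auto simp: sym_norm_def q0 max_def split: if_splits)
  show "sym_norm q (x - z) \<le> sym_norm q (x - y) + sym_norm q (y - z)"
    using tri[of "x - y" "y - z"] tri[of "z - y" "y - x"]
    by (auto simp: sym_norm_def max_def)
qed

definition asym_equivalent ::
  "('a::real_vector \<Rightarrow> real) \<Rightarrow> ('a \<Rightarrow> real) \<Rightarrow> bool" where
  "asym_equivalent q p \<longleftrightarrow>
     (\<exists>\<kappa>>0. \<exists>\<mu>>0. \<forall>x. \<kappa> * q x \<le> p x \<and> p x \<le> \<mu> * q x)"

definition right_bounded_with :: "real \<Rightarrow> ('a::real_vector \<Rightarrow> real) \<Rightarrow> bool" where
  "right_bounded_with r q \<longleftrightarrow>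
     (\<lambda>x. r *\<^sub>R x) ` asym_cball q 0 1 \<subseteq> asym_cball (sym_norm q) 0 1 + asym_kernel q"

definition right_bounded :: "('a::real_vector \<Rightarrow> real) \<Rightarrow> bool" where
  "right_bounded q \<longleftrightarrow> (\<exists>r>0. right_bounded_with r q)"

definition one_bounded :: "('a::real_vector \<Rightarrow> real) \<Rightarrow> bool" where
  "one_bounded q \<longleftrightarrow> right_bounded_with 1 q"

definition strongly_compact :: "('a::real_vector \<Rightarrow> real) \<Rightarrow> 'a set \<Rightarrow> bool" where
  "strongly_compact q K \<longleftrightarrow>
     (\<exists>S. compactin (sym_topology q) S \<and> S \<subseteq> K \<and> K \<subseteq> S + asym_kernel q)"

text \<open>Members of a \<^const>\<open>neighbourhood_base_of\<close> need not be open.\<close>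

definition strongly_locally_compact :: "('a::real_vector \<Rightarrow> real) \<Rightarrow> bool" where
  "strongly_locally_compact q \<longleftrightarrow>
     neighbourhood_base_of (strongly_compact q) (asym_topology q)"

end

theory Submission
  imports Defs
begin

text \<open>
  The cycle (1) \<open>\<Longrightarrow>\<close> (2) \<open>\<Longrightarrow>\<close> (3) \<open>\<Longrightarrow>\<close> (4) \<open>\<Longrightarrow>\<close> (1) is proved. Finite dimension is used only through
  the Heine--Borel property of the norm \<open>q\<^sup>s\<close>, that its closed balls are \<open>q\<^sup>s\<close>-compact
  (\<open>compactin_sym_norm_cball\<close>). This follows from the compactness of cubes of coordinates, once
  the coordinates with respect to a basis are known to be bounded by a multiple of \<open>q\<^sup>s\<close>.

  For (1) \<open>\<Longrightarrow>\<close> (2), the new norm is the \<open>p\<^sup>s\<close>-distance from a point to \<open>\<theta>\<^sub>p\<close>,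
  \<open>q x = (INF t\<in>\<theta>\<^sub>p. p\<^sup>s (x - t))\<close>. Subtracting elements of \<open>\<theta>\<^sub>p\<close> cannot make \<open>p\<close> smaller,
  so \<open>p \<le> q\<close>; right boundedness with radius \<open>r\<close> says precisely that \<open>r q \<le> p\<close>. By compactness
  the infimum is attained, at \<open>t\<close> say, and then \<open>x - t\<close> has \<open>p\<^sup>s\<close>-norm, hence also \<open>q\<^sup>s\<close>-norm, at
  most \<open>q x\<close>. So every point of the closed unit ball of \<open>q\<close> differs by an element of
  \<open>\<theta>\<^sub>p = \<theta>\<^sub>q\<close> from a point of the closed unit ball of \<open>q\<^sup>s\<close>, which is 1-boundedness.

  For (2) \<open>\<Longrightarrow>\<close> (3), the closed unit ball of \<open>q\<^sup>s\<close> is the compact core of that of \<open>q\<close>. For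
  (3) \<open>\<Longrightarrow>\<close> (4), dilations and translations preserve strong compactness, also when passing to an
  equivalent norm, so all closed \<open>q\<close>-balls are strongly compact for \<open>p\<close>; they form
  neighbourhood bases. For (4) \<open>\<Longrightarrow>\<close> (1), a strongly compact neighbourhood of \<open>0\<close> lies in
  \<open>S + \<theta>\<^sub>p\<close> with \<open>S\<close> bounded in \<open>p\<^sup>s\<close>, and rescaling gives right boundedness.
\<close>

section \<open>Asymmetric norms and their symmetrisation\<close>

lemma asym_norm_nonneg: "asym_norm q \<Longrightarrow> 0 \<le> q x"
  and asym_norm_scale: "asym_norm q \<Longrightarrow> 0 \<le> a \<Longrightarrow> q (a *\<^sub>R x) = a * q x"
  and asym_norm_triangle: "asym_norm q \<Longrightarrow> q (x + y) \<le> q x + q y"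
  and asym_norm_eq_zeroD: "asym_norm q \<Longrightarrow> q x = 0 \<Longrightarrow> q (- x) = 0 \<Longrightarrow> x = 0"
  by (auto simp: asym_norm_def)

lemma asym_norm_zero: "asym_norm q \<Longrightarrow> q 0 = 0"
  using asym_norm_scale[of q 0 0] by simp

lemma le_sym_norm: "q x \<le> sym_norm q x"
  by (simp add: sym_norm_def)

lemma sym_norm_nonneg: "asym_norm q \<Longrightarrow> 0 \<le> sym_norm q x"
  using asym_norm_nonneg le_sym_norm order_trans by metis

lemma sym_norm_minus: "sym_norm q (- x) = sym_norm q x"
  by (simp add: sym_norm_def max.commute)

lemma sym_norm_zero: "asym_norm q \<Longrightarrow> sym_norm q 0 = 0"
  by (simp add: sym_norm_def asym_norm_zero)

lemma sym_norm_eq_zeroD: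
  assumes "asym_norm q" "sym_norm q x = 0"
  shows "x = 0"
  using assms asym_norm_nonneg[of q x] asym_norm_nonneg[of q "- x"]
  by (intro asym_norm_eq_zeroD[of q]) (auto simp: sym_norm_def max_def split: if_splits)

lemma sym_norm_triangle:
  assumes "asym_norm q"
  shows "sym_norm q (x + y) \<le> sym_norm q x + sym_norm q y"
  using asym_norm_triangle[OF assms, of x y] asym_norm_triangle[OF assms, of "- x" "- y"]
  by (auto simp: sym_norm_def max_def)

lemma sym_norm_scale_nonneg:
  assumes "asym_norm q" "0 \<le> a"
  shows "sym_norm q (a *\<^sub>R x) = a * sym_norm q x"
  using asym_norm_scale[OF assms, of x] asym_norm_scale[OF assms, of "- x"] assms(2)
  by (simp add: sym_norm_def max_mult_distrib_left)

lemma sym_norm_scale: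
  assumes "asym_norm q"
  shows "sym_norm q (a *\<^sub>R x) = \<bar>a\<bar> * sym_norm q x"
proof (cases "0 \<le> a")
  case False
  then have "sym_norm q (a *\<^sub>R x) = sym_norm q ((- a) *\<^sub>R x)"
    using sym_norm_minus[of q "a *\<^sub>R x"] by simp
  then show ?thesis
    using False assms by (simp add: sym_norm_scale_nonneg del: scaleR_minus_left)
qed (simp add: assms sym_norm_scale_nonneg)

lemma sym_norm_sum:
  assumes "asym_norm q"
  shows "sym_norm q (\<Sum>i\<in>I. f i) \<le> (\<Sum>i\<in>I. sym_norm q (f i))"
proof (induction I rule: infinite_finite_induct)
  case (insert i I)
  then show ?case
    using sym_norm_triangle[OF assms, of "f i" "\<Sum>i\<in>I. f i"] by simp
qed (simp_all add: assms sym_norm_zero)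

lemma asym_kernel_add:
  assumes "asym_norm q" "x \<in> asym_kernel q" "y \<in> asym_kernel q"
  shows "x + y \<in> asym_kernel q"
  using assms asym_norm_triangle[OF assms(1), of x y] asym_norm_nonneg[OF assms(1), of "x + y"]
  by (simp add: asym_kernel_def)

lemma asym_kernel_scale:
  "asym_norm q \<Longrightarrow> 0 \<le> a \<Longrightarrow> x \<in> asym_kernel q \<Longrightarrow> a *\<^sub>R x \<in> asym_kernel q"
  by (simp add: asym_kernel_def asym_norm_scale)

lemma asym_kernel_equivalent:
  assumes "asym_equivalent q p"
  shows "asym_kernel q \<subseteq> asym_kernel p"
proof
  fix x assume "x \<in> asym_kernel q"
  moreover obtain \<kappa> \<mu> where "0 < \<kappa>" "0 < \<mu>" "\<And>x. \<kappa> * q x \<le> p x \<and> p x \<le> \<mu> * q x"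
    using assms by (auto simp: asym_equivalent_def)
  ultimately show "x \<in> asym_kernel p"
    unfolding asym_kernel_def by (metis antisym mem_Collect_eq mult_zero_right)
qed

section \<open>The norm topology and the Heine--Borel property\<close>

lemma topspace_sym_topology [simp]: "asym_norm q \<Longrightarrow> topspace (sym_topology q) = UNIV"
  unfolding sym_topology_def
  using Metric_space.topspace_mtopology[OF Metric_space_sym_norm[of q]] by simp

text \<open>
  This covers real-valued functions on the normed space as well as affine maps between two
  symmetrised norms on the same space, since the target is an arbitrary metric.
\<close>

lemma continuous_map_Lipschitz_sym_topology:
  assumes q: "asym_norm q" and M: "Metric_space UNIV d"
    and L: "\<And>x y. d (f x) (f y) \<le> L * sym_norm q (x - y)"
  shows "continuous_map (sym_topology q) (Metric_space.mtopology UNIV d) f"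
proof -
  interpret S: Metric_space UNIV "\<lambda>x y. sym_norm q (x - y)"
    using Metric_space_sym_norm[OF q] .
  interpret M: Metric_space UNIV d by fact
  show ?thesis
    unfolding M.continuous_map_to_metric
  proof (intro ballI allI impI)
    fix x and e :: real
    assume "0 < e"
    \<comment> \<open>The Lipschitz constant may vanish or be negative, but the radius divides by it.\<close>
    define L' where "L' = \<bar>L\<bar> + 1"
    have L': "0 < L'" by (simp add: L'_def)
    show "\<exists>U. openin (sym_topology q) U \<and> x \<in> U \<and> (\<forall>y\<in>U. f y \<in> M.mball (f x) e)"
    proof (intro exI conjI ballI)
      show "openin (sym_topology q) (S.mball x (e / L'))"
        by (simp add: sym_topology_def)
      show "x \<in> S.mball x (e / L')"
        using \<open>0 < e\<close> L' by (simp add: sym_norm_zero q)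
      fix y assume "y \<in> S.mball x (e / L')"
      then have "L' * sym_norm q (x - y) < e"
        using L' by (simp add: field_simps)
      moreover have "L * sym_norm q (x - y) \<le> L' * sym_norm q (x - y)"
        by (intro mult_right_mono sym_norm_nonneg[OF q]) (simp add: L'_def)
      ultimately show "f y \<in> M.mball (f x) e"
        using L[of x y] by simp
    qed
  qed
qed

lemma continuous_map_sym_topology_real:
  fixes f :: "'a::real_vector \<Rightarrow> real"
  assumes "asym_norm q" and "\<And>x y. f x \<le> f y + sym_norm q (x - y)"
  shows "continuous_map (sym_topology q) euclideanreal f"
proof -
  have "dist (f x) (f y) \<le> 1 * sym_norm q (x - y)" for x y
    using assms(2)[of x y] assms(2)[of y x] sym_norm_minus[of q "x - y"]
    by (simp add: dist_real_def)
  then show ?thesis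
    using continuous_map_Lipschitz_sym_topology[OF assms(1) Met_TC.Metric_space_axioms, of f 1]
    by simp
qed

lemma continuous_map_sym_norm:
  assumes "asym_norm q"
  shows "continuous_map (sym_topology q) euclideanreal (sym_norm q)"
proof (rule continuous_map_sym_topology_real[OF assms])
  show "sym_norm q x \<le> sym_norm q y + sym_norm q (x - y)" for x y
    using sym_norm_triangle[OF assms, of y "x - y"] by simp
qed

lemma closedin_sublevel_sym_topology:
  fixes f :: "'a::real_vector \<Rightarrow> real"
  assumes "asym_norm q" "continuous_map (sym_topology q) euclideanreal f"
  shows "closedin (sym_topology q) {x. f x \<le> c}"
  using closedin_continuous_map_preimage[OF assms(2), of "{..c}"] assms(1) by simp

lemma continuous_map_linear_combination:
  fixes B :: "'a::real_vector set"
  assumes q: "asym_norm q" and B: "finite B"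
  shows "continuous_map (product_topology (\<lambda>_. euclideanreal) B) (sym_topology q)
           (\<lambda>c. \<Sum>b\<in>B. c b *\<^sub>R b)"
    (is "continuous_map ?P _ ?\<phi>")
proof -
  interpret S: Metric_space UNIV "\<lambda>x y. sym_norm q (x - y)"
    using Metric_space_sym_norm[OF q] .
  show ?thesis
    unfolding sym_topology_def S.continuous_map_to_metric
  proof (intro ballI allI impI)
    fix c and e :: real
    assume c: "c \<in> topspace ?P" and e: "0 < e"
    define g where "g = (\<lambda>c'. \<Sum>b\<in>B. \<bar>c b - c' b\<bar> * sym_norm q b)"
    have "continuous_map ?P euclideanreal g"
      unfolding g_def
      by (intro continuous_map_sum continuous_map_real_mult continuous_map_real_abs
          continuous_map_diff continuous_map_product_projection B) auto
    from openin_continuous_map_preimage[OF this, of "{..<e}"]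
    have op: "openin ?P {c' \<in> topspace ?P. g c' < e}"
      by simp
    \<comment> \<open>The function \<open>g\<close> bounds the distance of the two combinations and is continuous.\<close>
    have "?\<phi> c' \<in> S.mball (?\<phi> c) e" if "g c' < e" for c'
    proof -
      have "sym_norm q (?\<phi> c - ?\<phi> c') = sym_norm q (\<Sum>b\<in>B. (c b - c' b) *\<^sub>R b)"
        by (simp add: sum_subtractf scaleR_left_diff_distrib)
      also have "\<dots> \<le> g c'"
        unfolding g_def using sym_norm_sum[OF q, of "\<lambda>b. (c b - c' b) *\<^sub>R b" B]
        by (simp add: sym_norm_scale[OF q])
      finally show ?thesis using that by simp
    qed
    then show "\<exists>U. openin ?P U \<and> c \<in> U \<and> (\<forall>y\<in>U. ?\<phi> y \<in> S.mball (?\<phi> c) e)"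
      using op c e by (intro exI[of _ "{c' \<in> topspace ?P. g c' < e}"]) (auto simp: g_def)
  qed
qed

text \<open>
  On the unit sphere of the sup-norm of coordinates, which is compact, the continuous function
  \<open>c \<mapsto> q\<^sup>s (\<Sum>b\<in>B. c b *\<^sub>R b)\<close> has a minimum \<open>m\<close>. Independence of \<open>B\<close> makes \<open>m\<close> positive, and
  \<open>1 / m\<close> is the required constant by homogeneity.
\<close>

lemma coordinates_bounded_by_sym_norm:
  fixes B :: "'a::real_vector set"
  assumes q: "asym_norm q" and B: "finite B" "independent B"
  obtains C where "0 < C"
    "\<And>c b. b \<in> B \<Longrightarrow> \<bar>c b\<bar> \<le> C * sym_norm q (\<Sum>b\<in>B. c b *\<^sub>R b)"
proof (cases "B = {}")
  case True
  then show ?thesis using that[of 1] by simp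
next
  case False
  define \<phi> where "\<phi> = (\<lambda>c. \<Sum>b\<in>B. c b *\<^sub>R b)"
  define P where "P = product_topology (\<lambda>_::'a. euclideanreal) B"
  \<comment> \<open>The unit sphere is the union of the pairs \<open>F b\<close> of opposite faces of the cube, each of which
    is a product of compact sets.\<close>
  define F where "F = (\<lambda>b. PiE B (\<lambda>b'. if b' = b then {-1, 1} else {-1..1::real}))"
  define T where "T = (\<Union>b\<in>B. F b)"
  have "compactin P (F b)" for b
    by (auto simp: P_def F_def compactin_PiE)
  then have "compactin P T"
    unfolding T_def using B(1) by (intro compactin_Union) auto
  moreover have "continuous_map P euclideanreal (sym_norm q \<circ> \<phi>)"
    using continuous_map_compose continuous_map_linear_combination[OF q B(1)]
      continuous_map_sym_norm[OF q]
    unfolding P_def \<phi>_def by blast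
  ultimately have "compact ((sym_norm q \<circ> \<phi>) ` T)"
    using image_compactin by fastforce
  moreover have "T \<noteq> {}"
    using False by (auto simp: T_def F_def PiE_eq_empty_iff)
  ultimately obtain c0 where c0: "c0 \<in> T"
    and c0_min: "\<And>c. c \<in> T \<Longrightarrow> sym_norm q (\<phi> c0) \<le> sym_norm q (\<phi> c)"
    using compact_attains_inf[of "(sym_norm q \<circ> \<phi>) ` T"] by auto
  define m where "m = sym_norm q (\<phi> c0)"
  have "\<phi> c0 \<noteq> 0"
  proof
    assume "\<phi> c0 = 0"
    then have "\<forall>b\<in>B. c0 b = 0"
      using independentD[OF B(2,1) subset_refl, of c0] by (simp add: \<phi>_def)
    with c0 show False
      by (auto simp: T_def F_def PiE_def Pi_def split: if_splits)
  qed
  then have m: "0 < m"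
    using sym_norm_eq_zeroD[OF q] sym_norm_nonneg[OF q, of "\<phi> c0"]
    unfolding m_def by (metis less_eq_real_def)
  show ?thesis
  proof (rule that[of "1 / m"])
    fix c :: "'a \<Rightarrow> real" and b assume b: "b \<in> B"
    have "Max ((\<lambda>b. \<bar>c b\<bar>) ` B) \<in> (\<lambda>b. \<bar>c b\<bar>) ` B"
      using B(1) False by (intro Max_in) auto
    then obtain b1 where b1: "b1 \<in> B" "\<bar>c b1\<bar> = Max ((\<lambda>b. \<bar>c b\<bar>) ` B)"
      by auto
    then have b1_max: "\<bar>c b'\<bar> \<le> \<bar>c b1\<bar>" if "b' \<in> B" for b'
      using B(1) that by simp
    define M where "M = \<bar>c b1\<bar>"
    have "m * M \<le> sym_norm q (\<phi> c)"
    proof (cases "M = 0")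
      case True
      then show ?thesis by (simp add: sym_norm_nonneg q)
    next
      case False
      then have M: "0 < M" by (simp add: M_def)
      have "c b' / M \<in> {-1..1}" if "b' \<in> B" for b'
      proof -
        have "- M \<le> c b'" "c b' \<le> M"
          using b1_max[OF that] by (auto simp: M_def abs_le_iff)
        then show ?thesis using M by (simp add: field_simps)
      qed
      moreover have "c b1 / M \<in> {-1, 1}"
        using M by (auto simp: M_def abs_if)
      ultimately have "restrict (\<lambda>b. c b / M) B \<in> F b1"
        unfolding F_def by (intro restrict_PiE_iff[THEN iffD2] ballI) simp
      then have "m \<le> sym_norm q (\<phi> (restrict (\<lambda>b. c b / M) B))"
        unfolding m_def using b1 by (intro c0_min) (auto simp: T_def)
      also have "\<phi> (restrict (\<lambda>b. c b / M) B) = (1 / M) *\<^sub>R \<phi> c"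
        by (simp add: \<phi>_def scaleR_sum_right)
      finally show ?thesis
        using M by (simp add: sym_norm_scale[OF q] field_simps)
    qed
    then have "M \<le> 1 / m * sym_norm q (\<phi> c)"
      using m by (simp add: field_simps)
    then show "\<bar>c b\<bar> \<le> 1 / m * sym_norm q (\<Sum>b\<in>B. c b *\<^sub>R b)"
      using b1_max[OF b] by (simp add: M_def \<phi>_def)
  qed (use m in simp)
qed

lemma compactin_sym_norm_cball:
  fixes q :: "'a::real_vector \<Rightarrow> real"
  assumes fin: "\<exists>B :: 'a set. finite B \<and> span B = UNIV" and q: "asym_norm q"
  shows "compactin (sym_topology q) (asym_cball (sym_norm q) 0 R)"
proof -
  obtain A :: "'a set" where A: "finite A" "span A = UNIV" using fin by blast
  obtain B where "B \<subseteq> A" and indep: "independent B" and "A \<subseteq> span B"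
    using maximal_independent_subset[of A] by blast
  then have B: "finite B" "span B = UNIV"
    using A span_minimal[of A "span B"] finite_subset by auto
  obtain C where C: "0 < C"
    "\<And>c b. b \<in> B \<Longrightarrow> \<bar>c b\<bar> \<le> C * sym_norm q (\<Sum>b\<in>B. c b *\<^sub>R b)"
    using coordinates_bounded_by_sym_norm[OF q B(1) indep] by metis
  define Q where "Q = PiE B (\<lambda>_. {- (C * R)..C * R})"
  define \<phi> where "\<phi> = (\<lambda>c. \<Sum>b\<in>B. c b *\<^sub>R b)"
  have "compactin (product_topology (\<lambda>_. euclideanreal) B) Q"
    by (auto simp: Q_def compactin_PiE)
  then have "compactin (sym_topology q) (\<phi> ` Q)"
    unfolding \<phi>_def
    by (rule image_compactin[OF _ continuous_map_linear_combination[OF q B(1)]])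
  moreover have "asym_cball (sym_norm q) 0 R \<subseteq> \<phi> ` Q"
  proof
    fix x assume x: "x \<in> asym_cball (sym_norm q) 0 R"
    obtain c where c: "x = (\<Sum>b\<in>B. c b *\<^sub>R b)"
      using B span_finite[OF B(1)] by blast
    have "\<bar>c b\<bar> \<le> C * R" if "b \<in> B" for b
    proof -
      have "C * sym_norm q x \<le> C * R"
        using x C(1) by (simp add: asym_cball_def)
      then show ?thesis using C(2)[OF that, of c] c by simp
    qed
    then have "restrict c B \<in> Q"
      by (fastforce simp: Q_def abs_le_iff)
    moreover have "\<phi> (restrict c B) = x"
      by (simp add: \<phi>_def c)
    ultimately show "x \<in> \<phi> ` Q" by blast
  qed
  moreover have "closedin (sym_topology q) (asym_cball (sym_norm q) 0 R)"
    using closedin_sublevel_sym_topology[OF q continuous_map_sym_norm[OF q]]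
    by (simp add: asym_cball_def)
  ultimately show ?thesis
    by (rule closed_compactin)
qed

section \<open>The distance to the kernel\<close>

definition kernel_distance :: "('a::real_vector \<Rightarrow> real) \<Rightarrow> 'a \<Rightarrow> real" where
  "kernel_distance p x = (INF t\<in>asym_kernel p. sym_norm p (x - t))"

lemma kernel_distance_le:
  assumes "asym_norm p" "t \<in> asym_kernel p"
  shows "kernel_distance p x \<le> sym_norm p (x - t)"
  unfolding kernel_distance_def
  by (rule cINF_lower[OF _ assms(2)]) (auto intro!: bdd_belowI sym_norm_nonneg assms)

text \<open>
  Only points of norm at most \<open>p\<^sup>s x\<close> compete for the infimum, because \<open>x\<close> itself does
  (\<open>t = 0\<close>). Those among them that lie in \<open>x - \<theta>\<^sub>p\<close> form a compact set: \<open>\<theta>\<^sub>p\<close> is closed for \<open>p\<^sup>s\<close>,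
  as \<open>p\<close> is \<open>p\<^sup>s\<close>-continuous.
\<close>

lemma kernel_distance_attained:
  fixes p :: "'a::real_vector \<Rightarrow> real"
  assumes fin: "\<exists>B :: 'a set. finite B \<and> span B = UNIV" and p: "asym_norm p"
  obtains t where "t \<in> asym_kernel p" "kernel_distance p x = sym_norm p (x - t)"
proof -
  let ?T = "sym_topology p"
  have zero: "0 \<in> asym_kernel p"
    by (simp add: asym_kernel_def asym_norm_zero p)
  define K where "K = asym_cball (sym_norm p) 0 (sym_norm p x) \<inter> {y. p (x - y) \<le> 0}"
  have "continuous_map ?T euclideanreal (\<lambda>y. p (x - y))"
  proof (rule continuous_map_sym_topology_real[OF p])
    show "p (x - y) \<le> p (x - z) + sym_norm p (y - z)" for y z
      using asym_norm_triangle[OF p, of "x - z" "z - y"] le_sym_norm[of p "z - y"]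
        sym_norm_minus[of p "y - z"] by simp
  qed
  then have "compactin ?T K"
    unfolding K_def
    by (intro compact_Int_closedin compactin_sym_norm_cball fin p closedin_sublevel_sym_topology)
  then have "compact (sym_norm p ` K)"
    using image_compactin[OF _ continuous_map_sym_norm[OF p]] by simp
  moreover have xK: "x \<in> K"
    by (simp add: K_def asym_cball_def asym_norm_zero p)
  ultimately obtain y where y: "y \<in> K" and y_min: "\<And>z. z \<in> K \<Longrightarrow> sym_norm p y \<le> sym_norm p z"
    using compact_attains_inf[of "sym_norm p ` K"] by auto
  have ker: "x - y \<in> asym_kernel p"
    using y asym_norm_nonneg[OF p, of "x - y"] by (simp add: K_def asym_kernel_def)
  have "sym_norm p y \<le> sym_norm p (x - t)" if "t \<in> asym_kernel p" for t
  proof (cases "sym_norm p (x - t) \<le> sym_norm p x")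
    case True
    then show ?thesis
      using that by (intro y_min) (simp add: K_def asym_cball_def asym_kernel_def)
  next
    case False
    then show ?thesis using y_min[OF xK] by simp
  qed
  then have "sym_norm p y \<le> kernel_distance p x"
    unfolding kernel_distance_def using zero by (intro cINF_greatest) auto
  with kernel_distance_le[OF p ker, of x] ker show ?thesis
    by (intro that[of "x - y"]) auto
qed

lemma le_kernel_distance:
  fixes p :: "'a::real_vector \<Rightarrow> real"
  assumes "\<exists>B :: 'a set. finite B \<and> span B = UNIV" and p: "asym_norm p"
  shows "p x \<le> kernel_distance p x"
proof -
  obtain t where t: "t \<in> asym_kernel p" "kernel_distance p x = sym_norm p (x - t)"
    using kernel_distance_attained[OF assms] .
  then show ?thesis
    using asym_norm_triangle[OF p, of "x - t" t] le_sym_norm[of p "x - t"]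
    by (simp add: asym_kernel_def)
qed

lemma kernel_distance_kernel:
  assumes p: "asym_norm p" and "p x = 0"
  shows "kernel_distance p x \<le> 0"
  using kernel_distance_le[OF p, of x x] assms by (simp add: asym_kernel_def sym_norm_zero)

lemma asym_norm_kernel_distance:
  fixes p :: "'a::real_vector \<Rightarrow> real"
  assumes fin: "\<exists>B :: 'a set. finite B \<and> span B = UNIV" and p: "asym_norm p"
  shows "asym_norm (kernel_distance p)"
  unfolding asym_norm_def
proof (intro conjI allI impI)
  let ?q = "kernel_distance p"
  note attained = kernel_distance_attained[OF fin p]
  show nonneg: "0 \<le> ?q x" for x
    using le_kernel_distance[OF fin p, of x] asym_norm_nonneg[OF p, of x] by simp
  have scale_le: "?q (a *\<^sub>R x) \<le> a * ?q x" if "0 \<le> a" for a x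
  proof -
    obtain t where t: "t \<in> asym_kernel p" "?q x = sym_norm p (x - t)"
      using attained .
    show ?thesis
      using kernel_distance_le[OF p asym_kernel_scale[OF p that t(1)], of "a *\<^sub>R x"] that
      by (simp add: t(2) sym_norm_scale_nonneg[OF p] flip: scaleR_diff_right)
  qed
  show "?q (a *\<^sub>R x) = a * ?q x" if "0 \<le> a" for a x
  proof (cases "a = 0")
    case True
    then show ?thesis using scale_le[of 0 x] nonneg[of 0] by simp
  next
    case False
    then show ?thesis
      using scale_le[OF that, of x] scale_le[of "1 / a" "a *\<^sub>R x"] that
      by (simp add: field_simps)
  qed
  show "?q (x + y) \<le> ?q x + ?q y" for x y
  proof -
    obtain s where s: "s \<in> asym_kernel p" "?q x = sym_norm p (x - s)"
      using attained .
    obtain t where t: "t \<in> asym_kernel p" "?q y = sym_norm p (y - t)"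
      using attained .
    show ?thesis
      using kernel_distance_le[OF p asym_kernel_add[OF p s(1) t(1)], of "x + y"]
        sym_norm_triangle[OF p, of "x - s" "y - t"]
      by (simp add: s(2) t(2) algebra_simps)
  qed
  show "x = 0" if "?q x = 0 \<and> ?q (- x) = 0" for x
    using that le_kernel_distance[OF fin p, of x] le_kernel_distance[OF fin p, of "- x"]
      asym_norm_nonneg[OF p, of x] asym_norm_nonneg[OF p, of "- x"]
    by (intro asym_norm_eq_zeroD[OF p]) auto
qed

text \<open>
  A nearest point \<open>t\<close> of the kernel gives the decomposition \<open>x = (x - t) + t\<close>. That the distance is
  attained is what gives the radius exactly 1; points that are merely almost nearest would give
  every radius below 1.
\<close>

lemma one_bounded_kernel_distance:
  fixes p :: "'a::real_vector \<Rightarrow> real"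
  assumes fin: "\<exists>B :: 'a set. finite B \<and> span B = UNIV" and p: "asym_norm p"
  shows "one_bounded (kernel_distance p)"
  unfolding one_bounded_def right_bounded_with_def
proof clarify
  let ?q = "kernel_distance p"
  fix x assume "x \<in> asym_cball ?q 0 1"
  then have x: "?q x \<le> 1" by (simp add: asym_cball_def)
  obtain t where t: "t \<in> asym_kernel p" "?q x = sym_norm p (x - t)"
    using kernel_distance_attained[OF fin p] .
  have "0 \<in> asym_kernel p"
    by (simp add: asym_kernel_def asym_norm_zero p)
  then have "?q y \<le> sym_norm p y" for y
    using kernel_distance_le[OF p, of 0 y] by simp
  from this[of "x - t"] this[of "- (x - t)"] have "sym_norm ?q (x - t) \<le> 1"
    using x t(2) unfolding sym_norm_minus by (simp add: sym_norm_def[of ?q])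
  moreover have "t \<in> asym_kernel ?q"
    using kernel_distance_kernel[OF p, of t] t(1)
      asym_norm_nonneg[OF asym_norm_kernel_distance[OF fin p], of t]
    by (simp add: asym_kernel_def)
  ultimately have "(x - t) + t \<in> asym_cball (sym_norm ?q) 0 1 + asym_kernel ?q"
    by (intro set_plus_intro) (simp_all add: asym_cball_def)
  then show "1 *\<^sub>R x \<in> asym_cball (sym_norm ?q) 0 1 + asym_kernel ?q"
    by simp
qed

text \<open>
  Normalise \<open>x\<close> to \<open>p\<close>-norm 1 and decompose it by right boundedness; scaled back, the summand in
  the kernel witnesses that \<open>x\<close> has distance at most \<open>p x / r\<close> from the kernel.
\<close>

lemma right_bounded_imp_kernel_distance_le:
  assumes p: "asym_norm p" and r: "0 < r" "right_bounded_with r p"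
  shows "r * kernel_distance p x \<le> p x"
proof (cases "p x = 0")
  case True
  then show ?thesis
    using kernel_distance_kernel[OF p True] r(1) by (simp add: mult_nonneg_nonpos)
next
  case False
  then have px: "0 < p x" using asym_norm_nonneg[OF p, of x] by simp
  define y where "y = (1 / p x) *\<^sub>R x"
  have "p y = 1"
    using px asym_norm_scale[OF p, of "1 / p x" x] by (simp add: y_def)
  then have y_in: "y \<in> asym_cball p 0 1"
    by (simp add: asym_cball_def)
  have "r *\<^sub>R y \<in> asym_cball (sym_norm p) 0 1 + asym_kernel p"
    using r(2) y_in unfolding right_bounded_with_def by blast
  then obtain s t where st: "r *\<^sub>R y = s + t" "sym_norm p s \<le> 1" "t \<in> asym_kernel p"
    by (auto simp: set_plus_def asym_cball_def)
  define a where "a = p x / r"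
  have a: "0 < a" using px r(1) by (simp add: a_def)
  have "x = a *\<^sub>R (r *\<^sub>R y)" using px r(1) by (simp add: a_def y_def)
  then have x: "x - a *\<^sub>R t = a *\<^sub>R s" by (simp add: st(1) scaleR_right_distrib)
  have "kernel_distance p x \<le> sym_norm p (x - a *\<^sub>R t)"
    using a by (intro kernel_distance_le p asym_kernel_scale st(3)) simp
  also have "\<dots> = a * sym_norm p s"
    unfolding x using a by (simp add: sym_norm_scale_nonneg[OF p])
  also have "\<dots> \<le> a" using a st(2) by simp
  finally show ?thesis using r(1) by (simp add: a_def field_simps)
qed

section \<open>Topology and strongly compact sets\<close>

lemma openin_asym_ball: "0 < e \<Longrightarrow> openin (asym_topology q) (asym_ball q x e)"
  unfolding asym_topology_def by (rule topology_generated_by_Basis) blast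

lemma centre_in_asym_ball: "asym_norm q \<Longrightarrow> 0 < e \<Longrightarrow> x \<in> asym_ball q x e"
  by (simp add: asym_ball_def asym_norm_zero)

text \<open>
  The balls are only a subbase of the topology by definition; the triangle inequality makes those
  centred at a given point a local base there.
\<close>

lemma openin_asym_topologyD:
  assumes q: "asym_norm q" and "openin (asym_topology q) U" "x \<in> U"
  obtains e where "0 < e" "asym_ball q x e \<subseteq> U"
proof -
  have "generate_topology_on {asym_ball q x e | x e. 0 < e} U"
    using assms(2) by (simp add: asym_topology_def openin_topology_generated_by_iff)
  then have "\<forall>x\<in>U. \<exists>e>0. asym_ball q x e \<subseteq> U"
  proof induction
    case (Int a b)
    show ?case
    proof
      fix x assume "x \<in> a \<inter> b"
      then obtain d e where "0 < d" "0 < e" "asym_ball q x d \<subseteq> a" "asym_ball q x e \<subseteq> b"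
        using Int by (metis IntD1 IntD2)
      then show "\<exists>e>0. asym_ball q x e \<subseteq> a \<inter> b"
        by (intro exI[of _ "min d e"]) (auto simp: asym_ball_def)
    qed
  next
    case (Basis s)
    then obtain y d where s: "s = asym_ball q y d" by blast
    show ?case
    proof
      fix x assume "x \<in> s"
      then have "0 < d - q (x - y)" by (simp add: s asym_ball_def)
      moreover have "asym_ball q x (d - q (x - y)) \<subseteq> s"
      proof
        fix z assume "z \<in> asym_ball q x (d - q (x - y))"
        then show "z \<in> s"
          using asym_norm_triangle[OF q, of "z - x" "x - y"] by (simp add: s asym_ball_def)
      qed
      ultimately show "\<exists>e>0. asym_ball q x e \<subseteq> s" by blast
    qed
  qed (simp, blast)
  then show ?thesis using assms(3) that by blast
qed

lemma asym_equivalent_sym_norm: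
  assumes "asym_equivalent q p"
  obtains L where "\<And>x. sym_norm p x \<le> L * sym_norm q x"
proof -
  obtain \<mu> where \<mu>: "0 < \<mu>" "\<And>x. p x \<le> \<mu> * q x"
    using assms by (auto simp: asym_equivalent_def)
  have "sym_norm p x \<le> \<mu> * sym_norm q x" for x
    using \<mu>(2)[of x] \<mu>(2)[of "- x"] \<mu>(1)
    by (auto simp: sym_norm_def max_mult_distrib_left le_max_iff_disj)
  then show ?thesis using that by blast
qed

text \<open>
  An affine map with nonnegative ratio maps kernel translates of a set into kernel translates of
  its image, and it is Lipschitz from \<open>q\<^sup>s\<close> to \<open>p\<^sup>s\<close>, so it carries the compact core of \<open>K\<close> to one of
  the image.
\<close>

lemma strongly_compact_affine_image:
  assumes q: "asym_norm q" and p: "asym_norm p" and eq: "asym_equivalent q p"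
    and K: "strongly_compact q K" and \<delta>: "0 \<le> \<delta>"
  shows "strongly_compact p ((\<lambda>x. a + \<delta> *\<^sub>R x) ` K)"
proof -
  define f where "f = (\<lambda>x. a + \<delta> *\<^sub>R x)"
  obtain S where S: "compactin (sym_topology q) S" "S \<subseteq> K" "K \<subseteq> S + asym_kernel q"
    using K by (auto simp: strongly_compact_def)
  obtain L where L: "\<And>x. sym_norm p x \<le> L * sym_norm q x"
    using asym_equivalent_sym_norm[OF eq] by blast
  have "sym_norm p (f x - f y) \<le> (\<delta> * L) * sym_norm q (x - y)" for x y
    using mult_left_mono[OF L[of "x - y"] \<delta>]
    by (simp add: f_def sym_norm_scale_nonneg[OF p \<delta>] mult.assoc flip: scaleR_diff_right)
  then have "continuous_map (sym_topology q) (sym_topology p) f"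
    unfolding sym_topology_def[of p]
    by (rule continuous_map_Lipschitz_sym_topology[OF q Metric_space_sym_norm[OF p]])
  then have "compactin (sym_topology p) (f ` S)"
    by (rule image_compactin[OF S(1)])
  moreover have "f ` K \<subseteq> f ` S + asym_kernel p"
  proof clarify
    fix x assume "x \<in> K"
    then obtain s t where st: "x = s + t" "s \<in> S" "t \<in> asym_kernel q"
      using S(3) by (auto elim!: set_plus_elim)
    have "\<delta> *\<^sub>R t \<in> asym_kernel p"
      using asym_kernel_equivalent[OF eq] st(3) asym_kernel_scale[OF p \<delta>] by blast
    then have "f s + \<delta> *\<^sub>R t \<in> f ` S + asym_kernel p"
      using st(2) by (intro set_plus_intro) auto
    then show "f x \<in> f ` S + asym_kernel p"
      by (simp add: f_def st(1) scaleR_right_distrib add.assoc)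
  qed
  ultimately show ?thesis
    using S(2) unfolding strongly_compact_def f_def[symmetric] by blast
qed

lemma asym_cball_affine_image:
  assumes "asym_norm q" "0 < \<delta>"
  shows "asym_cball q x \<delta> = (\<lambda>y. x + \<delta> *\<^sub>R y) ` asym_cball q 0 1"
proof
  show "asym_cball q x \<delta> \<subseteq> (\<lambda>y. x + \<delta> *\<^sub>R y) ` asym_cball q 0 1"
  proof
    fix z assume "z \<in> asym_cball q x \<delta>"
    then have "(1 / \<delta>) *\<^sub>R (z - x) \<in> asym_cball q 0 1"
      using assms asym_norm_scale[of q "1 / \<delta>" "z - x"] by (simp add: asym_cball_def)
    moreover have "z = x + \<delta> *\<^sub>R ((1 / \<delta>) *\<^sub>R (z - x))" using assms(2) by simp
    ultimately show "z \<in> (\<lambda>y. x + \<delta> *\<^sub>R y) ` asym_cball q 0 1" by blast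
  qed
qed (use assms in \<open>auto simp: asym_cball_def asym_norm_scale\<close>)

section \<open>The equivalence\<close>

lemma one_bounded_imp_strongly_compact_cball:
  fixes q :: "'a::real_vector \<Rightarrow> real"
  assumes "\<exists>B :: 'a set. finite B \<and> span B = UNIV" "asym_norm q" "one_bounded q"
  shows "strongly_compact q (asym_cball q 0 1)"
  unfolding strongly_compact_def
proof (intro exI conjI)
  show "compactin (sym_topology q) (asym_cball (sym_norm q) 0 1)"
    by (rule compactin_sym_norm_cball[OF assms(1,2)])
  show "asym_cball (sym_norm q) 0 1 \<subseteq> asym_cball q 0 1"
    using le_sym_norm order_trans by (fastforce simp: asym_cball_def)
  show "asym_cball q 0 1 \<subseteq> asym_cball (sym_norm q) 0 1 + asym_kernel q"
    using assms(3) by (simp add: one_bounded_def right_bounded_with_def)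
qed

lemma strongly_compact_cball_imp_strongly_locally_compact:
  assumes q: "asym_norm q" and p: "asym_norm p" and eq: "asym_equivalent q p"
    and K: "strongly_compact q (asym_cball q 0 1)"
  shows "strongly_locally_compact p"
  unfolding strongly_locally_compact_def neighbourhood_base_of
proof clarify
  fix W x assume "openin (asym_topology p) W" "x \<in> W"
  then obtain e where e: "0 < e" "asym_ball p x e \<subseteq> W"
    using openin_asym_topologyD[OF p] by metis
  obtain \<kappa> \<mu> where \<kappa>: "0 < \<kappa>" "\<And>x. \<kappa> * q x \<le> p x" and \<mu>: "0 < \<mu>" "\<And>x. p x \<le> \<mu> * q x"
    using eq by (auto simp: asym_equivalent_def)
  define \<delta> where "\<delta> = e / (2 * \<mu>)"
  have \<delta>: "0 < \<delta>" "\<mu> * \<delta> < e" using e(1) \<mu>(1) by (auto simp: \<delta>_def)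
  show "\<exists>U V. openin (asym_topology p) U \<and> strongly_compact p V \<and> x \<in> U \<and> U \<subseteq> V \<and> V \<subseteq> W"
  proof (intro exI conjI)
    show "openin (asym_topology p) (asym_ball p x (\<kappa> * \<delta>))" "x \<in> asym_ball p x (\<kappa> * \<delta>)"
      using \<kappa>(1) \<delta>(1) by (simp_all add: openin_asym_ball centre_in_asym_ball p)
    show "strongly_compact p (asym_cball q x \<delta>)"
      unfolding asym_cball_affine_image[OF q \<delta>(1)]
      using \<delta>(1) by (intro strongly_compact_affine_image[OF q p eq K]) simp
    show "asym_ball p x (\<kappa> * \<delta>) \<subseteq> asym_cball q x \<delta>"
    proof
      fix y assume "y \<in> asym_ball p x (\<kappa> * \<delta>)"
      then have "\<kappa> * q (y - x) < \<kappa> * \<delta>"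
        using \<kappa>(2)[of "y - x"] by (simp add: asym_ball_def)
      then show "y \<in> asym_cball q x \<delta>" using \<kappa>(1) by (simp add: asym_cball_def)
    qed
    show "asym_cball q x \<delta> \<subseteq> W"
    proof
      fix y assume "y \<in> asym_cball q x \<delta>"
      then have "\<mu> * q (y - x) \<le> \<mu> * \<delta>" using \<mu>(1) by (simp add: asym_cball_def)
      then have "y \<in> asym_ball p x e"
        using \<mu>(2)[of "y - x"] \<delta>(2) by (simp add: asym_ball_def)
      then show "y \<in> W" using e(2) by blast
    qed
  qed
qed

lemma strongly_locally_compact_imp_right_bounded:
  assumes p: "asym_norm p" and slc: "strongly_locally_compact p"
  shows "right_bounded p"
proof -
  obtain U V where U: "openin (asym_topology p) U" "0 \<in> U" "U \<subseteq> V"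
    and V: "strongly_compact p V"
    using slc openin_asym_ball[of 1 p 0] centre_in_asym_ball[OF p, of 1 0]
    unfolding strongly_locally_compact_def neighbourhood_base_of by (metis zero_less_one)
  obtain e where e: "0 < e" "asym_ball p 0 e \<subseteq> U"
    using openin_asym_topologyD[OF p U(1,2)] .
  obtain S where S: "compactin (sym_topology p) S" "V \<subseteq> S + asym_kernel p"
    using V by (auto simp: strongly_compact_def)
  have "compact (sym_norm p ` S)"
    using image_compactin[OF S(1) continuous_map_sym_norm[OF p]] by simp
  then obtain M where M: "0 < M" "\<And>s. s \<in> S \<Longrightarrow> sym_norm p s \<le> M"
    using compact_imp_bounded bounded_pos by (metis abs_le_D1 imageI real_norm_def)
  define r where "r = e / (2 * M)"
  have "right_bounded_with r p"
    unfolding right_bounded_with_def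
  proof clarify
    fix x assume "x \<in> asym_cball p 0 1"
    then have x: "p x \<le> 1" by (simp add: asym_cball_def)
    have "p ((e / 2) *\<^sub>R x) = e / 2 * p x"
      using e(1) by (intro asym_norm_scale[OF p]) simp
    also have "\<dots> \<le> e / 2 * 1"
      using e(1) x by (intro mult_left_mono) auto
    also have "\<dots> < e" using e(1) by simp
    finally have "p ((e / 2) *\<^sub>R x) < e" .
    then have "(e / 2) *\<^sub>R x \<in> S + asym_kernel p"
      using e(2) U(3) S(2) by (auto simp: asym_ball_def)
    then obtain s t where st: "(e / 2) *\<^sub>R x = s + t" "s \<in> S" "t \<in> asym_kernel p"
      by (auto elim!: set_plus_elim)
    have "r *\<^sub>R x = (1 / M) *\<^sub>R ((e / 2) *\<^sub>R x)" by (simp add: r_def)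
    also have "\<dots> = (1 / M) *\<^sub>R s + (1 / M) *\<^sub>R t" by (simp add: st(1) scaleR_right_distrib)
    also have "\<dots> \<in> asym_cball (sym_norm p) 0 1 + asym_kernel p"
    proof (rule set_plus_intro)
      show "(1 / M) *\<^sub>R s \<in> asym_cball (sym_norm p) 0 1"
        using M st(2) by (simp add: asym_cball_def sym_norm_scale_nonneg[OF p])
      show "(1 / M) *\<^sub>R t \<in> asym_kernel p"
        using M(1) by (intro asym_kernel_scale[OF p] st(3)) simp
    qed
    finally show "r *\<^sub>R x \<in> asym_cball (sym_norm p) 0 1 + asym_kernel p" .
  qed
  moreover have "0 < r" using e(1) M(1) by (simp add: r_def)
  ultimately show ?thesis by (auto simp: right_bounded_def)
qed

theorem theorem4p7:
  fixes p :: "'a::real_vector \<Rightarrow> real"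
  assumes "\<exists>B :: 'a set. finite B \<and> span B = UNIV"
    and "asym_norm p"
  shows "(right_bounded p \<longleftrightarrow>
            (\<exists>q. asym_norm q \<and> asym_equivalent q p \<and> one_bounded q))
       \<and> ((\<exists>q. asym_norm q \<and> asym_equivalent q p \<and> one_bounded q) \<longleftrightarrow>
            (\<exists>q. asym_norm q \<and> asym_equivalent q p \<and> strongly_compact q (asym_cball q 0 1)))
       \<and> ((\<exists>q. asym_norm q \<and> asym_equivalent q p \<and> strongly_compact q (asym_cball q 0 1)) \<longleftrightarrow>
            strongly_locally_compact p)"
proof -
  have "\<exists>q. asym_norm q \<and> asym_equivalent q p \<and> one_bounded q" if "right_bounded p"
  proof (intro exI conjI)
    obtain r where r: "0 < r" "right_bounded_with r p"
      using \<open>right_bounded p\<close> by (auto simp: right_bounded_def)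
    have "r * kernel_distance p x \<le> p x \<and> p x \<le> 1 * kernel_distance p x" for x
      using right_bounded_imp_kernel_distance_le[OF assms(2) r] le_kernel_distance[OF assms]
      by simp
    with r(1) show "asym_equivalent (kernel_distance p) p"
      unfolding asym_equivalent_def using zero_less_one by blast
  qed (fact asym_norm_kernel_distance[OF assms] one_bounded_kernel_distance[OF assms])+
  moreover have "\<exists>q. asym_norm q \<and> asym_equivalent q p \<and> strongly_compact q (asym_cball q 0 1)"
    if "\<exists>q. asym_norm q \<and> asym_equivalent q p \<and> one_bounded q"
    using that one_bounded_imp_strongly_compact_cball[OF assms(1)] by blast
  moreover have "strongly_locally_compact p"
    if "\<exists>q. asym_norm q \<and> asym_equivalent q p \<and> strongly_compact q (asym_cball q 0 1)"
    using that strongly_compact_cball_imp_strongly_locally_compact[OF _ assms(2)] by blast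
  moreover have "right_bounded p" if "strongly_locally_compact p"
    using strongly_locally_compact_imp_right_bounded[OF assms(2) that] .
  ultimately show ?thesis by blast
qed

end
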